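(* For every integer $d\ge 1$ there exists a (finite, simple, non-empty) $d$-regular graph $G$ whose weak degeneracy satisfies $\mathrm{wd}(G)=\lfloor d/2\rfloor+1$.
   Context: All graphs are finite and simple, with non-empty vertex set. A graph is $d$-regular if every vertex has degree $d$. $\mathbb{N}$ denotes the nonnegative integers. Operation $\mathrm{Delete}(G,f,u)$: given a graph $G$, a function $f:V(G)\to\mathbb{N}$ and a vertex $u\in V(G)$, it outputs the graph $G'=G-u$ and the function $f':V(G')\to\mathbb{Z}$ with $f'(v)=f(v)-1$ if $uv\in E(G)$ and $f'(v)=f(v)$ otherwise. It is legal if $f'$ is nonnegative. Operation $\mathrm{DeleteSave}(G,f,u,w)$: given a graph $G$, a function $f:V(G)\to\mathbb{N}$ and adjacent vertices $u,w\in V(G)$, it outputs $G'=G-u$ and $f':V(G')\to\mathbb{Z}$ with $f'(v)=f(v)-1$ if $uv\in E(G)$ and $v\ne w$, and $f'(v)=f(v)$ otherwise. It is legal if $f(u)>f(w)$ and $f'$ is nonnegative. $G$ is weakly $f$-degenerate if all vertices of $G$ can be removed by a sequence of legal applications of Delete and DeleteSave, starting from $(G,f)$, each operation being applied to the graph and function output by the previous one. For $k\in\mathbb{N}$, $G$ is weakly $k$-degenerate if it is weakly $f$-degenerate for the constant function $f\equiv k$. The weak degeneracy $\mathrm{wd}(G)$ is the minimum $k\in\mathbb{N}$ such that $G$ is weakly $k$-degenerate. *)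

theory Defs
  imports "Graph_Theory.Digraph"
begin

(* Finite simple graphs are the symmetric, loop-free finite digraphs without parallel arcs of the
   locale graph: every edge uv is the pair of arcs u -> v and v -> u, so the degree of a vertex
   is its out-degree. That locale admits the graph without vertices, which the vertex removals
   below end in. *)

definition regular :: "('a, 'b) pre_digraph \<Rightarrow> nat \<Rightarrow> bool" where
  "regular G d \<longleftrightarrow> (\<forall>v\<in>verts G. out_degree G v = d)"

(* A function on V(G) is a total function of which only the values on verts G matter.
   It is integer-valued because an operation may output negative values; legality excludes them. *)

definition nonneg_on :: "'a set \<Rightarrow> ('a \<Rightarrow> int) \<Rightarrow> bool" where
  "nonneg_on V f \<longleftrightarrow> (\<forall>v\<in>V. 0 \<le> f v)"

type_synonym ('a, 'b) weighted = "('a, 'b) pre_digraph \<times> ('a \<Rightarrow> int)"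

definition Delete :: "('a, 'b) pre_digraph \<Rightarrow> ('a \<Rightarrow> int) \<Rightarrow> 'a \<Rightarrow> ('a, 'b) weighted" where
  "Delete G f u =
    (pre_digraph.del_vert G u,
     \<lambda>v. if u \<rightarrow>\<^bsub>G\<^esub> v then f v - 1 else f v)"

definition DeleteSave :: "('a, 'b) pre_digraph \<Rightarrow> ('a \<Rightarrow> int) \<Rightarrow> 'a \<Rightarrow> 'a \<Rightarrow> ('a, 'b) weighted" where
  "DeleteSave G f u w =
    (pre_digraph.del_vert G u,
     \<lambda>v. if u \<rightarrow>\<^bsub>G\<^esub> v \<and> v \<noteq> w then f v - 1 else f v)"

definition legal_Delete :: "('a, 'b) pre_digraph \<Rightarrow> ('a \<Rightarrow> int) \<Rightarrow> 'a \<Rightarrow> bool" where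
  "legal_Delete G f u \<longleftrightarrow>
    u \<in> verts G \<and> (case Delete G f u of (G', f') \<Rightarrow> nonneg_on (verts G') f')"

definition legal_DeleteSave :: "('a, 'b) pre_digraph \<Rightarrow> ('a \<Rightarrow> int) \<Rightarrow> 'a \<Rightarrow> 'a \<Rightarrow> bool" where
  "legal_DeleteSave G f u w \<longleftrightarrow>
    u \<in> verts G \<and> w \<in> verts G \<and> u \<rightarrow>\<^bsub>G\<^esub> w \<and> f u > f w \<and>
    (case DeleteSave G f u w of (G', f') \<Rightarrow> nonneg_on (verts G') f')"

inductive legal_step :: "('a, 'b) weighted \<Rightarrow> ('a, 'b) weighted \<Rightarrow> bool" where
  delete: "legal_Delete G f u \<Longrightarrow> legal_step (G, f) (Delete G f u)"
| delete_save: "legal_DeleteSave G f u w \<Longrightarrow> legal_step (G, f) (DeleteSave G f u w)"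

definition weakly_f_degenerate :: "('a, 'b) pre_digraph \<Rightarrow> ('a \<Rightarrow> nat) \<Rightarrow> bool" where
  "weakly_f_degenerate G f \<longleftrightarrow>
    (\<exists>H h. legal_step\<^sup>*\<^sup>* (G, \<lambda>v. int (f v)) (H, h) \<and> verts H = {})"

definition weakly_degenerate :: "('a, 'b) pre_digraph \<Rightarrow> nat \<Rightarrow> bool" where
  "weakly_degenerate G k \<longleftrightarrow> weakly_f_degenerate G (\<lambda>_. k)"

definition wd :: "('a, 'b) pre_digraph \<Rightarrow> nat" where
  "wd G = (LEAST k. weakly_degenerate G k)"

(* The minimum defining wd is attained for every finite graph. *)

lemma legal_steps_to_empty:
  assumes "finite (verts G)" "\<And>v. v \<in> verts G \<Longrightarrow> int (card (verts G)) \<le> f v"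
  shows "\<exists>H h. legal_step\<^sup>*\<^sup>* (G, f) (H, h) \<and> verts H = {}"
  using assms
proof (induction "card (verts G)" arbitrary: G f)
  case 0
  then show ?case by auto
next
  case (Suc n)
  then obtain u where u: "u \<in> verts G" by fastforce
  obtain G' f' where D: "Delete G f u = (G', f')" by fastforce
  then have V: "verts G' = verts G - {u}"
    and f': "f' = (\<lambda>v. if u \<rightarrow>\<^bsub>G\<^esub> v then f v - 1 else f v)"
    by (auto simp: Delete_def pre_digraph.del_vert_def)
  have c: "card (verts G') = n" "finite (verts G')" using Suc.hyps(2) Suc.prems(1) u V by auto
  have b: "int (card (verts G')) \<le> f' v" if "v \<in> verts G'" for v
    using Suc.prems(2)[of v] Suc.hyps(2) that V c f' by auto
  then have "legal_Delete G f u"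
    unfolding legal_Delete_def D nonneg_on_def using u by force
  then have "legal_step (G, f) (G', f')" using D delete by metis
  moreover obtain H h where "legal_step\<^sup>*\<^sup>* (G', f') (H, h)" "verts H = {}"
    using Suc.hyps(1)[of G' f'] c b by auto
  ultimately show ?case by (meson converse_rtranclp_into_rtranclp)
qed

lemma weakly_degenerate_wd:
  assumes "finite (verts G)"
  shows "weakly_degenerate G (wd G)"
proof -
  have "weakly_degenerate G (card (verts G))"
    unfolding weakly_degenerate_def weakly_f_degenerate_def
    using assms by (intro legal_steps_to_empty) auto
  then show ?thesis unfolding wd_def by (rule LeastI)
qed

end

theory Submission
  imports Defs
begin

text \<open>
  Lower bound: \<open>2 * (\<Sum>v. f v) - 2 * |E|\<close> drops by \<open>2 * f u\<close> when \<open>u\<close> is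
  deleted and by \<open>2 * f u - 2 \<ge> 0\<close> when a neighbour is saved, because then \<open>f u > f w \<ge> 0\<close>. So it
  never increases and it ends at 0. The first operation on a constant function \<open>k > 0\<close> cannot
  save, so it lowers the quantity strictly, and its initial value \<open>|V| * (2 * k - d)\<close> is positive.

  Upper bound, with \<open>k = d div 2 + 1\<close>: arrange vertices in a sequence in which all but the last ones have at most \<open>k\<close>
  earlier neighbours. Each of the last vertices \<open>y\<close> has \<open>d\<close> earlier neighbours, of which
  \<open>d - k + 1\<close> are among the very first vertices. These still have the full value \<open>k\<close>, so each
  of them, except the first neighbour of \<open>y\<close>, can save \<open>y\<close>. Thus \<open>y\<close> loses only \<open>k\<close>. A
  sequence of vertices with \<open>k\<close> earlier and \<open>d - k\<close> later neighbours absorbs the surplus edges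
  that leave the first vertices.
\<close>

subsection \<open>The lower bound\<close>

lemma arcs_ends_del_vert:
  "arcs_ends (pre_digraph.del_vert G u) = {(v, w) \<in> arcs_ends G. v \<noteq> u \<and> w \<noteq> u}"
  by (auto simp: arcs_ends_conv pre_digraph.del_vert_def)

lemma graph_del_vert:
  assumes "graph G"
  shows "graph (pre_digraph.del_vert G u)"
proof -
  interpret graph G by fact
  interpret D: fin_digraph "del_vert u" by (rule fin_digraph_del_vert)
  have "sym (arcs_ends (del_vert u))"
    using sym_arcs unfolding arcs_ends_del_vert symmetric_def sym_def by auto
  moreover have "digraph (del_vert u)"
    by unfold_locales
      (auto simp: del_vert_simps arc_to_ends_def intro: no_multi_arcs dest: no_loops)
  ultimately show ?thesis by (intro digraph.graphI) (auto simp: symmetric_def)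
qed

text \<open>Every edge at \<open>u\<close> contributes two ordered pairs, distinct because there are
  no loops.\<close>

lemma card_arcs_ends:
  assumes "graph G"
  shows "card (arcs_ends G) =
    card (arcs_ends (pre_digraph.del_vert G u)) + 2 * card {v. u \<rightarrow>\<^bsub>G\<^esub> v}"
proof -
  interpret graph G by fact
  let ?N = "{v. u \<rightarrow>\<^bsub>G\<^esub> v}"
  have fin: "finite (arcs_ends G)" by (simp add: arcs_ends_def)
  have finN: "finite ?N"
    by (rule finite_subset[of _ "verts G"]) (auto dest: adj_in_verts)
  have irr: "\<not> u \<rightarrow>\<^bsub>G\<^esub> u" using adj_not_same by blast
  have sym: "v \<rightarrow>\<^bsub>G\<^esub> w \<Longrightarrow> w \<rightarrow>\<^bsub>G\<^esub> v" for v w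
    using arcs_ends_symmetric[OF sym_arcs] .
  have eq: "arcs_ends G = arcs_ends (del_vert u) \<union> (Pair u ` ?N \<union> (\<lambda>v. (v, u)) ` ?N)"
    using sym unfolding arcs_ends_del_vert by auto
  have "card (Pair u ` ?N \<union> (\<lambda>v. (v, u)) ` ?N) = card ?N + card ?N"
    using finN irr by (subst card_Un_disjoint) (auto simp: card_image inj_on_def)
  moreover have "card (arcs_ends G) = card (arcs_ends (del_vert u))
      + card (Pair u ` ?N \<union> (\<lambda>v. (v, u)) ` ?N)"
    using fin finN by (subst eq, subst card_Un_disjoint)
      (auto simp: arcs_ends_del_vert intro: finite_subset[OF _ fin])
  ultimately show ?thesis by simp
qed

lemma card_arcs_ends_regular:
  assumes "graph G" "regular G d"
  shows "card (arcs_ends G) = card (verts G) * d"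
proof -
  interpret graph G by fact
  have "card (arcs_ends G) = card (arcs G)"
    unfolding arcs_ends_def by (rule card_image[OF inj_on_arc_to_ends])
  also have "arcs G = (\<Union>v\<in>verts G. out_arcs G v)" by auto
  also have "card \<dots> = (\<Sum>v\<in>verts G. card (out_arcs G v))"
    by (rule card_UN_disjoint) auto
  also have "\<dots> = card (verts G) * d"
    using assms(2) by (simp add: regular_def out_degree_def)
  finally show ?thesis .
qed

section \<open>The potential and its change under the two operations\<close>

definition potential :: "('a, 'b) weighted \<Rightarrow> int" where
  "potential = (\<lambda>(G, f). 2 * (\<Sum>v\<in>verts G. f v) - int (card (arcs_ends G)))"

lemma sum_decrement:
  fixes f :: "'a \<Rightarrow> int"
  assumes "finite A"
  shows "(\<Sum>v\<in>A. if P v then f v - 1 else f v) = sum f A - int (card {v\<in>A. P v})"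
proof -
  have "(\<Sum>v\<in>A. if P v then f v - 1 else f v) = (\<Sum>v\<in>A. f v - of_bool (P v))"
    by (rule sum.cong) auto
  also have "\<dots> = sum f A - int (card {v\<in>A. P v})"
    using assms by (simp add: sum_subtractf sum_of_bool_eq Int_def)
  finally show ?thesis .
qed

text \<open>Each neighbour of \<open>u\<close> lowers the doubled sum by 2 and the arc count by 2,
  so these terms cancel and only the value of \<open>u\<close> itself is lost.\<close>

lemma potential_Delete:
  assumes "graph G" "u \<in> verts G"
  shows "potential (Delete G f u) = potential (G, f) - 2 * f u"
proof -
  interpret graph G by fact
  have "{v \<in> verts G. u \<rightarrow>\<^bsub>G\<^esub> v} = {v. u \<rightarrow>\<^bsub>G\<^esub> v}"
    by (auto dest: adj_in_verts)
  moreover have "\<not> u \<rightarrow>\<^bsub>G\<^esub> u" using adj_not_same by blast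
  ultimately show ?thesis
    using assms(2) card_arcs_ends[OF assms(1), of u]
    by (simp add: potential_def Delete_def sum_decrement verts_del_vert sum_diff1)
qed

lemma potential_DeleteSave:
  assumes "graph G" "u \<in> verts G" "u \<rightarrow>\<^bsub>G\<^esub> w"
  shows "potential (DeleteSave G f u w) = potential (G, f) - 2 * f u + 2"
proof -
  interpret graph G by fact
  have "{v \<in> verts G. u \<rightarrow>\<^bsub>G\<^esub> v \<and> v \<noteq> w} = {v. u \<rightarrow>\<^bsub>G\<^esub> v} - {w}"
    by (auto dest: adj_in_verts)
  moreover have "\<not> u \<rightarrow>\<^bsub>G\<^esub> u" using adj_not_same by blast
  moreover have "finite {v. u \<rightarrow>\<^bsub>G\<^esub> v}"
    by (rule finite_subset[of _ "verts G"]) (auto dest: adj_in_verts)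
  then have "card {v. u \<rightarrow>\<^bsub>G\<^esub> v} = Suc (card ({v. u \<rightarrow>\<^bsub>G\<^esub> v} - {w}))"
    using assms(3) by (intro card.remove) auto
  ultimately show ?thesis
    using assms(2) card_arcs_ends[OF assms(1), of u]
    by (simp add: potential_def DeleteSave_def sum_decrement verts_del_vert sum_diff1)
qed

lemma legal_step_potential:
  assumes "legal_step X Y" "graph (fst X)" "nonneg_on (verts (fst X)) (snd X)"
  shows "graph (fst Y) \<and> nonneg_on (verts (fst Y)) (snd Y) \<and> potential Y \<le> potential X"
  using assms
proof cases
  case (delete G f u)
  then show ?thesis
    using assms(2,3)
    by (auto simp: potential_Delete legal_Delete_def nonneg_on_def)
      (auto simp: Delete_def graph_del_vert)
next
  case (delete_save G f u w)
  then have "f u \<ge> 1" using assms(3) by (force simp: legal_DeleteSave_def nonneg_on_def)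
  then show ?thesis
    using delete_save assms(2,3)
    by (auto simp: potential_DeleteSave legal_DeleteSave_def)
      (auto simp: DeleteSave_def graph_del_vert)
qed

lemma legal_steps_potential:
  assumes "legal_step\<^sup>*\<^sup>* X Y" "graph (fst X)" "nonneg_on (verts (fst X)) (snd X)"
  shows "graph (fst Y) \<and> nonneg_on (verts (fst Y)) (snd Y) \<and> potential Y \<le> potential X"
  using assms
proof (induction rule: rtranclp_induct)
  case (step Y Z)
  then show ?case using legal_step_potential[of Y Z] by fastforce
qed simp

lemma weakly_degenerate_regular_ge:
  assumes "graph G" "verts G \<noteq> {}" "regular G d" "d \<ge> 1" "weakly_degenerate G k"
  shows "d div 2 + 1 \<le> k"
proof -
  interpret graph G by fact
  let ?X = "(G, \<lambda>_::'a. int k)"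
  obtain H h where steps: "legal_step\<^sup>*\<^sup>* ?X (H, h)" and H: "verts H = {}"
    using assms(5) unfolding weakly_degenerate_def weakly_f_degenerate_def by auto
  have "?X \<noteq> (H, h)" using H assms(2) by auto
  then obtain Y where Y: "legal_step ?X Y" "legal_step\<^sup>*\<^sup>* Y (H, h)"
    using steps by (metis converse_rtranclpE)
  have nn: "nonneg_on (verts G) (\<lambda>_. int k)" by (simp add: nonneg_on_def)
  have "potential Y = potential ?X - 2 * int k"
    using Y(1)
  proof cases
    case (delete u)
    then show ?thesis using assms(1) by (simp add: potential_Delete legal_Delete_def)
  next
    case (delete_save u w)
    then show ?thesis by (simp add: legal_DeleteSave_def)
  qed
  moreover have "graph H \<and> potential (H, h) \<le> potential Y"
    using legal_step_potential[OF Y(1)] legal_steps_potential[OF Y(2)] assms(1) nn by auto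
  moreover from this have "arcs H = {}"
    using H by (metis all_not_in_conv graph_def digraph_def fin_digraph_def wf_digraph.tail_in_verts)
  then have "potential (H, h) = 0" using H by (simp add: potential_def arcs_ends_def)
  moreover have "potential ?X = int (card (verts G)) * (2 * int k - int d)"
    using card_arcs_ends_regular[OF assms(1,3)]
    by (simp add: potential_def algebra_simps)
  ultimately have *: "int (card (verts G)) * (2 * int k - int d) \<ge> 2 * int k" by simp
  have "card (verts G) > 0" using assms(2) by (simp add: card_gt_0_iff)
  \<comment> \<open>Otherwise the left side of \<open>*\<close> is at most 0, which forces
    \<open>k = 0\<close>; then \<open>*\<close> contradicts \<open>d \<ge> 1\<close>.\<close>
  have "2 * int k > int d"
  proof (rule ccontr)
    assume neg: "\<not> ?thesis"
    then have "int (card (verts G)) * (2 * int k - int d) \<le> 0"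
      by (intro mult_nonneg_nonpos) auto
    then have "k = 0" using * by simp
    then show False using * assms(4) \<open>card (verts G) > 0\<close> by (simp add: mult_le_0_iff)
  qed
  then show ?thesis by linarith
qed

subsection \<open>Removal in the natural order\<close>

text \<open>\<open>E\<close> is symmetrised here so that it may be given as an orientation, from the
  vertex removed first to the one removed later. Arcs are pairs of vertices, which excludes parallel
  arcs.\<close>

definition graph_of :: "'a set \<Rightarrow> ('a \<Rightarrow> 'a \<Rightarrow> bool) \<Rightarrow> ('a, 'a \<times> 'a) pre_digraph" where
  "graph_of V E =
    \<lparr>verts = V, arcs = {(u, v). u \<in> V \<and> v \<in> V \<and> (E u v \<or> E v u)}, tail = fst, head = snd\<rparr>"

lemma verts_graph_of [simp]: "verts (graph_of V E) = V"
  by (simp add: graph_of_def)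

lemma dominates_graph_of [simp]:
  "u \<rightarrow>\<^bsub>graph_of V E\<^esub> v \<longleftrightarrow> u \<in> V \<and> v \<in> V \<and> (E u v \<or> E v u)"
  by (auto simp: graph_of_def arcs_ends_conv)

lemma del_vert_graph_of: "pre_digraph.del_vert (graph_of V E) u = graph_of (V - {u}) E"
  by (auto simp: graph_of_def pre_digraph.del_vert_def)

lemma out_degree_graph_of:
  assumes "v \<in> V"
  shows "out_degree (graph_of V E) v = card {w \<in> V. E v w \<or> E w v}"
proof -
  have "out_arcs (graph_of V E) v = Pair v ` {w \<in> V. E v w \<or> E w v}"
    using assms by (auto simp: graph_of_def out_arcs_def)
  then show ?thesis by (simp add: out_degree_def card_image inj_on_def)
qed

lemma graph_graph_of:
  assumes "finite V" "\<And>u. \<not> E u u"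
  shows "graph (graph_of V E)"
proof -
  have "finite {(u, v). u \<in> V \<and> v \<in> V \<and> (E u v \<or> E v u)}"
    by (rule finite_subset[of _ "V \<times> V"]) (use assms in auto)
  then have "digraph (graph_of V E)"
    using assms by unfold_locales (auto simp: graph_of_def arc_to_ends_def)
  moreover have "symmetric (graph_of V E)" by (auto simp: symmetric_def sym_def)
  ultimately show ?thesis by (intro digraph.graphI)
qed

text \<open>\<open>sv u\<close> is the neighbour, if any, that \<open>u\<close> saves. Just before
  vertex \<open>i\<close> is removed, \<open>v\<close> has value \<open>k - loss i v\<close>; so
  \<open>loss\<close> and \<open>save\<close> say that values stay nonnegative and that a saving
  vertex exceeds the saved one.\<close>

lemma weakly_degenerate_natural_order:
  fixes E :: "nat \<Rightarrow> nat \<Rightarrow> bool" and sv :: "nat \<Rightarrow> nat option" and T k :: nat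
  defines "loss \<equiv> \<lambda>i v. card {u. u < i \<and> E u v \<and> sv u \<noteq> Some v}"
  assumes less: "\<And>u v. E u v \<Longrightarrow> u < v"
    and loss: "\<And>v. v < T \<Longrightarrow> loss v v \<le> k"
    and save: "\<And>u w. u < T \<Longrightarrow> sv u = Some w \<Longrightarrow> w < T \<and> E u w \<and> loss u u < loss u w"
  shows "weakly_degenerate (graph_of {..<T} E) k"
proof -
  let ?G = "\<lambda>i. graph_of {i..<T} E"
  have loss_mono: "loss i v \<le> loss j v" if "i \<le> j" for i j v
    unfolding loss_def by (rule card_mono) (use that in auto)
  have loss_Suc: "loss (Suc i) v = (if E i v \<and> sv i \<noteq> Some v then loss i v + 1 else loss i v)"
    for i v
  proof -
    have "{u. u < Suc i \<and> E u v \<and> sv u \<noteq> Some v} =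
        (if E i v \<and> sv i \<noteq> Some v then {i} else {}) \<union> {u. u < i \<and> E u v \<and> sv u \<noteq> Some v}"
      by (auto simp: less_Suc_eq)
    then show ?thesis by (simp add: loss_def)
  qed
  have "\<exists>f. legal_step\<^sup>*\<^sup>* (?G 0, \<lambda>_. int k) (?G i, f) \<and>
      (\<forall>v\<in>{i..<T}. f v = int k - int (loss i v))" if "i \<le> T" for i
    using that
  proof (induction i)
    case 0
    then show ?case by (auto simp: loss_def)
  next
    case (Suc i)
    then obtain f where steps: "legal_step\<^sup>*\<^sup>* (?G 0, \<lambda>_. int k) (?G i, f)"
      and f: "\<And>v. v \<in> {i..<T} \<Longrightarrow> f v = int k - int (loss i v)" by auto
    have i: "i < T" using Suc.prems by simp
    have noE: "\<not> E v i" if "v \<ge> i" for v using less[of v i] that by auto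
    have del: "pre_digraph.del_vert (?G i) i = ?G (Suc i)"
      by (auto simp: del_vert_graph_of intro: arg_cong[where f = "\<lambda>V. graph_of V E"])
    \<comment> \<open>Losses only grow with time, so the bound at the moment \<open>v\<close> is
      removed covers all earlier moments.\<close>
    have final: "loss (Suc i) v \<le> k" if "v \<in> {Suc i..<T}" for v
      using loss_mono[of "Suc i" v v] loss[of v] that by auto
    have step: "\<exists>f'. legal_step (?G i, f) (?G (Suc i), f') \<and>
      (\<forall>v\<in>{Suc i..<T}. f' v = int k - int (loss (Suc i) v))"
    proof (cases "sv i")
      case None
      define f' where "f' = snd (Delete (?G i) f i)"
      have D: "Delete (?G i) f i = (?G (Suc i), f')"
        by (simp add: f'_def Delete_def del)
      have f': "f' v = int k - int (loss (Suc i) v)" if "v \<in> {Suc i..<T}" for v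
        using that f[of v] i noE[of v] None by (auto simp: f'_def Delete_def loss_Suc)
      have "legal_Delete (?G i) f i"
        using i f' final by (auto simp: legal_Delete_def D nonneg_on_def)
      then have "legal_step (?G i, f) (?G (Suc i), f')" using legal_step.delete D by metis
      then show ?thesis using f' by blast
    next
      case (Some w)
      then have w: "w < T" "E i w" "loss i i < loss i w" using save[OF i] by auto
      then have "i < w" using less by blast
      define f' where "f' = snd (DeleteSave (?G i) f i w)"
      have D: "DeleteSave (?G i) f i w = (?G (Suc i), f')"
        by (simp add: f'_def DeleteSave_def del)
      have f': "f' v = int k - int (loss (Suc i) v)" if "v \<in> {Suc i..<T}" for v
        using that f[of v] i noE[of v] Some by (auto simp: f'_def DeleteSave_def loss_Suc)
      have "legal_DeleteSave (?G i) f i w"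
        using i f' final w \<open>i < w\<close> f[of i] f[of w]
        by (auto simp: legal_DeleteSave_def D nonneg_on_def)
      then have "legal_step (?G i, f) (?G (Suc i), f')" using legal_step.delete_save D by metis
      then show ?thesis using f' by blast
    qed
    then show ?case using steps by (meson rtranclp.rtrancl_into_rtrancl)
  qed
  from this[of T] obtain f where "legal_step\<^sup>*\<^sup>* (?G 0, \<lambda>_. int k) (?G T, f)" by auto
  moreover have "?G 0 = graph_of {..<T} E" by (simp add: lessThan_atLeast0)
  ultimately show ?thesis
    unfolding weakly_degenerate_def weakly_f_degenerate_def by fastforce
qed

subsection \<open>Blow-ups of multigraphs\<close>

text \<open>
  The edges of a multigraph on the nodes below \<open>K\<close> are the numbers \<open>j < n\<close>. Replacing every
  node \<open>x\<close> by the \<open>n\<close> vertices \<open>x * n + c\<close>, \<open>c < n\<close>, and edge \<open>j\<close> by the perfect matching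
  that shifts \<open>c\<close> by \<open>j\<close> modulo \<open>n\<close> makes parallel edges disjoint, so the blow-up is simple,
  and the natural order of its vertices refines the order of the nodes.
\<close>

locale layered_multigraph =
  fixes n K :: nat and src tgt :: "nat \<Rightarrow> nat"
  assumes src_less_tgt: "j < n \<Longrightarrow> src j < tgt j"
    and tgt_less: "j < n \<Longrightarrow> tgt j < K"
begin

definition adj :: "nat \<Rightarrow> nat \<Rightarrow> bool" where
  "adj u v \<longleftrightarrow> (\<exists>j<n. u div n = src j \<and> v div n = tgt j \<and> v mod n = (u mod n + j) mod n)"

definition succ :: "nat \<Rightarrow> nat \<Rightarrow> nat" where
  "succ u j = tgt j * n + (u mod n + j) mod n"

definition pred :: "nat \<Rightarrow> nat \<Rightarrow> nat" where
  "pred v j = src j * n + (v mod n + (n - j)) mod n"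

lemma adj_less: "u < v" if "adj u v"
proof -
  from that obtain j where "j < n" "u div n = src j" "v div n = tgt j" by (auto simp: adj_def)
  then have "u div n < v div n" using src_less_tgt by simp
  then show ?thesis by (meson div_le_mono not_le)
qed

lemma succ_div [simp]: "succ u j div n = tgt j" if "j < n"
  using that by (simp add: succ_def)

lemma pred_div [simp]: "pred v j div n = src j" if "j < n"
  using that by (simp add: pred_def)

text \<open>Adding \<open>n - j\<close> inverts the shift by \<open>j\<close> modulo
  \<open>n\<close> without leaving the natural numbers.\<close>

lemma shift_iff:
  assumes "j < n" "a < n" "b < n"
  shows "b = (a + j) mod n \<longleftrightarrow> a = (b + (n - j)) mod n"
  using assms by (cases "a + j < n"; cases "b < j") (auto simp: mod_if)

lemma adj_succ_iff: "adj u v \<longleftrightarrow> (\<exists>j<n. src j = u div n \<and> v = succ u j)"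
proof -
  have "v div n = tgt j \<and> v mod n = (u mod n + j) mod n \<longleftrightarrow> v = succ u j" if "j < n" for j
  proof -
    have "v = succ u j \<longleftrightarrow> v div n = succ u j div n \<and> v mod n = succ u j mod n"
      by (metis div_mult_mod_eq)
    then show ?thesis using that by (simp add: succ_def)
  qed
  then show ?thesis unfolding adj_def by metis
qed

lemma adj_pred_iff: "adj u v \<longleftrightarrow> (\<exists>j<n. tgt j = v div n \<and> u = pred v j)"
proof -
  have "u div n = src j \<and> v mod n = (u mod n + j) mod n \<longleftrightarrow> u = pred v j" if "j < n" for j
  proof -
    have "u = pred v j \<longleftrightarrow> u div n = pred v j div n \<and> u mod n = pred v j mod n"
      by (metis div_mult_mod_eq)
    then show ?thesis using that shift_iff[of j "u mod n" "v mod n"] by (simp add: pred_def)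
  qed
  then show ?thesis unfolding adj_def by metis
qed

lemma succ_pred: "succ (pred v j) j = v" if "j < n" "tgt j = v div n"
proof -
  have "v mod n = (pred v j mod n + j) mod n"
    using that shift_iff[of j "pred v j mod n" "v mod n"] by (simp add: pred_def)
  then show ?thesis using that(2) unfolding succ_def by (metis div_mult_mod_eq)
qed

text \<open>As \<open>t\<close> runs below \<open>n\<close>, \<open>a + t\<close> runs through
  \<open>n\<close> consecutive numbers, so no residue repeats.\<close>

lemma shift_inj:
  assumes "(a + i) mod n = (a + j) mod n" "i < n" "j < n" "a < n"
  shows "i = j"
proof -
  have "(a + t) mod n = (if a + t < n then a + t else a + t - n)" if "t < n" for t
    using that assms(4) by (simp add: mod_if)
  then show ?thesis using assms by (auto split: if_splits)
qed

lemma inj_succ: "inj_on (succ u) {..<n}"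
proof (rule inj_onI)
  fix i j assume "i \<in> {..<n}" "j \<in> {..<n}" and eq: "succ u i = succ u j"
  then have ij: "i < n" "j < n" by auto
  moreover have "succ u i mod n = succ u j mod n" using eq by simp
  ultimately show "i = j" using ij shift_inj[of "u mod n" i j] by (simp add: succ_def)
qed

lemma inj_pred: "inj_on (pred v) {..<n}"
proof (rule inj_onI)
  fix i j assume "i \<in> {..<n}" "j \<in> {..<n}" and eq: "pred v i = pred v j"
  then have ij: "i < n" "j < n" by auto
  have "pred v i mod n = pred v j mod n" using eq by simp
  moreover have "v mod n = (pred v t mod n + t) mod n" if "t < n" for t
    using that shift_iff[of t "pred v t mod n" "v mod n"] by (simp add: pred_def)
  ultimately have "(pred v i mod n + i) mod n = (pred v i mod n + j) mod n" using ij by metis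
  then show "i = j" using shift_inj[of "pred v i mod n" i j] ij by simp
qed

definition blowup :: "(nat, nat \<times> nat) pre_digraph" where
  "blowup = graph_of {..<K * n} adj"

lemma less_iff_div: "v < K * n \<longleftrightarrow> v div n < K" if "n > 0"
  using that by (simp add: less_mult_imp_div_less div_less_iff_less_mult)

lemma graph_blowup: "graph blowup"
  unfolding blowup_def using adj_less by (intro graph_graph_of) auto

text \<open>Each edge at the node of \<open>v\<close> yields one neighbour of \<open>v\<close>.
  Injectivity of \<open>succ v\<close> and \<open>pred v\<close> keeps these distinct, and the order
  separates later from earlier neighbours.\<close>

lemma regular_blowup:
  assumes "\<And>x. x < K \<Longrightarrow> card {j. j < n \<and> src j = x} + card {j. j < n \<and> tgt j = x} = d"
  shows "regular blowup d"
  unfolding regular_def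
proof
  fix v assume "v \<in> verts blowup"
  then have v: "v < K * n" by (simp add: blowup_def)
  then have n: "n > 0" by (cases n) auto
  have V: "w < K * n" if "adj u w" for u w
  proof -
    from that obtain j where "j < n" "w div n = tgt j" by (auto simp: adj_def)
    then show ?thesis using tgt_less less_iff_div[OF n] by simp
  qed
  have finite: "finite {w. adj v w}" "finite {w. adj w v}"
    by (rule finite_subset[of _ "{..<K * n}"], use V in auto)
      (rule finite_subset[of _ "{..<v}"], use adj_less in auto)
  have "{w. adj v w} = succ v ` {j. j < n \<and> src j = v div n}"
    by (auto simp: adj_succ_iff)
  then have out: "card {w. adj v w} = card {j. j < n \<and> src j = v div n}"
    by (simp add: card_image inj_on_subset[OF inj_succ] subset_eq)
  have "{w. adj w v} = pred v ` {j. j < n \<and> tgt j = v div n}"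
    by (auto simp: adj_pred_iff)
  then have into: "card {w. adj w v} = card {j. j < n \<and> tgt j = v div n}"
    by (simp add: card_image inj_on_subset[OF inj_pred] subset_eq)
  have "{w \<in> {..<K * n}. adj v w \<or> adj w v} = {w. adj v w} \<union> {w. adj w v}"
    using V v adj_less by (fastforce dest: less_trans)
  moreover have "{w. adj v w} \<inter> {w. adj w v} = {}"
    using adj_less less_asym by blast
  ultimately have "card {w \<in> {..<K * n}. adj v w \<or> adj w v}
      = card {w. adj v w} + card {w. adj w v}"
    by (simp only: card_Un_disjoint finite)
  also have "\<dots> = d"
    unfolding out into by (rule assms) (use v less_iff_div[OF n] in blast)
  finally show "out_degree blowup v = d"
    using v by (simp add: blowup_def out_degree_graph_of)
qed

end


subsection \<open>The queue multigraph\<close>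

lemma card_div_eq:
  fixes a c x :: nat
  shows "card {j. j < a * c \<and> j div c = x} = (if x < a then c else 0)"
proof (cases "c = 0")
  case False
  have "j div c = x \<longleftrightarrow> j \<in> {x * c..<x * c + c}" for j
    using False dividend_less_times_div[of c j] div_times_less_eq_dividend[of j c]
    by (auto simp: mult.commute intro!: div_nat_eqI)
  moreover have "j < a * c \<longleftrightarrow> j div c < a" for j
    using False by (simp add: div_less_iff_less_mult)
  ultimately have "j < a * c \<and> j div c = x \<longleftrightarrow> x < a \<and> j \<in> {x * c..<x * c + c}" for j
    by metis
  then have "{j. j < a * c \<and> j div c = x} = {j. x < a \<and> j \<in> {x * c..<x * c + c}}"
    by (simp only:)
  then show ?thesis by (simp del: atLeastLessThan_iff)
qed auto

text \<open>
  The nodes are the sources \<open>0, \<dots>, l\<close>, the middle nodes \<open>l + 1, \<dots>, l + R\<close> and the last node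
  \<open>l + 1 + R\<close>. The half-edges leaving a source (\<open>k + l - 1\<close> of them) or a middle node (\<open>l\<close> of
  them) enter a queue, from which each middle node takes the first \<open>k\<close>; the equation \<open>balance\<close>
  says that \<open>k - 1\<close> of them remain for the last node. They are the edges \<open>j < J\<close>. Edge \<open>J + x\<close>
  joins source \<open>x\<close> directly to the last node.
\<close>

locale queue_multigraph =
  fixes k l R :: nat
  assumes l_less_k: "l < k"
    and balance: "Suc l * (k + l - 1) + R * l = k * R + (k - 1)"
begin

definition J :: nat where "J = k * R + (k - 1)"

definition N :: nat where "N = J + Suc l"

definition K :: nat where "K = Suc (Suc l + R)"

definition q_src :: "nat \<Rightarrow> nat" where
  "q_src j = (if j < Suc l * (k + l - 1) then j div (k + l - 1)
    else if j < J then Suc l + (j - Suc l * (k + l - 1)) div l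
    else j - J)"

text \<open>The \<open>k - 1\<close> leftover queue edges have \<open>j div k = R\<close>, so the
  first branch already sends them to the last node.\<close>

definition q_tgt :: "nat \<Rightarrow> nat" where
  "q_tgt j = (if j < J then Suc l + j div k else Suc l + R)"

text \<open>The critical case is a middle node \<open>i\<close>: its half-edges must enter the queue
  behind the \<open>k * Suc i\<close> ones taken by the middle nodes up to \<open>i\<close>.\<close>

lemma q_src_less_tgt:
  assumes "j < N"
  shows "q_src j < q_tgt j"
proof -
  consider "j < Suc l * (k + l - 1)" | "Suc l * (k + l - 1) \<le> j" "j < J" | "J \<le> j" by linarith
  then show ?thesis
  proof cases
    case 1
    then have "j div (k + l - 1) < Suc l" by (rule less_mult_imp_div_less)
    moreover have "j < J" using 1 balance by (simp add: J_def)
    ultimately show ?thesis using 1 by (simp add: q_src_def q_tgt_def)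
  next
    case 2
    define i where "i = (j - Suc l * (k + l - 1)) div l"
    have "j - Suc l * (k + l - 1) < R * l" using 2 balance by (simp add: J_def)
    then have "i < R" unfolding i_def by (rule less_mult_imp_div_less)
    then obtain r where r: "R = Suc i + r" by (metis Suc_leI le_iff_add)
    obtain g where g: "k = l + Suc g" using l_less_k less_imp_Suc_add by auto
    have "i * l \<le> j - Suc l * (k + l - 1)" by (simp add: i_def)
    then have "Suc l * (k + l - 1) + i * l \<le> j" using 2 by simp
    \<comment> \<open>By \<open>balance\<close> the right side exceeds the left by
      \<open>(k - l) * r + (k - 1 - l)\<close>; \<open>g\<close> removes the truncated
      subtractions.\<close>
    moreover have "k * Suc i \<le> Suc l * (k + l - 1) + i * l"
      using balance unfolding r g by (simp add: algebra_simps)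
    ultimately have "Suc i \<le> j div k"
      using l_less_k by (simp add: less_eq_div_iff_mult_less_eq mult.commute)
    then show ?thesis using 2 by (simp add: q_src_def q_tgt_def i_def)
  next
    case 3
    then have "\<not> j < Suc l * (k + l - 1)" using balance by (simp add: J_def)
    then show ?thesis using 3 assms by (simp add: q_src_def q_tgt_def N_def)
  qed
qed

lemma div_le_R: "j div k \<le> R" if "j < J"
  using that l_less_k
  by (simp add: J_def less_Suc_eq_le[symmetric] div_less_iff_less_mult algebra_simps)

sublocale layered_multigraph N K q_src q_tgt
  by unfold_locales (auto simp: q_src_less_tgt, auto simp: q_tgt_def K_def less_Suc_eq_le div_le_R)

section \<open>Degrees of the nodes\<close>

lemma out_source:
  assumes "x \<le> l"
  shows "card {j. j < N \<and> q_src j = x} = k + l"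
proof -
  have "{j. j < N \<and> q_src j = x} =
      insert (J + x) {j. j < Suc l * (k + l - 1) \<and> j div (k + l - 1) = x}"
    using assms balance by (auto simp: q_src_def J_def N_def split: if_splits)
  moreover have "J + x \<notin> {j. j < Suc l * (k + l - 1) \<and> j div (k + l - 1) = x}"
    using balance by (simp add: J_def)
  ultimately show ?thesis
    using assms l_less_k by (simp add: card_div_eq del: mult_Suc)
qed

lemma in_source: "{j. j < N \<and> q_tgt j = x} = {}" if "x \<le> l"
  using that by (auto simp: q_tgt_def)

lemma out_middle:
  assumes "i < R"
  shows "card {j. j < N \<and> q_src j = Suc l + i} = l"
proof -
  let ?o = "Suc l * (k + l - 1)"
  have "{j. j < N \<and> q_src j = Suc l + i} = (+) ?o ` {j. j < R * l \<and> j div l = i}"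
    (is "?A = ?B")
  proof
    show "?A \<subseteq> ?B"
    proof
      fix j assume j: "j \<in> ?A"
      have "j \<ge> ?o" using j less_mult_imp_div_less[of j "Suc l" "k + l - 1"]
        by (auto simp: q_src_def simp del: mult_Suc split: if_splits)
      moreover from this have "j < J" using j by (auto simp: q_src_def N_def split: if_splits)
      ultimately have "j = ?o + (j - ?o)" "j - ?o < R * l" "(j - ?o) div l = i"
        using j balance by (simp_all add: q_src_def J_def less_diff_conv2 del: mult_Suc)
      then show "j \<in> ?B" by blast
    qed
    show "?B \<subseteq> ?A"
      using balance by (auto simp: q_src_def J_def N_def)
  qed
  then show ?thesis using assms by (simp add: card_image card_div_eq)
qed

lemma in_middle:
  assumes "i < R"
  shows "card {j. j < N \<and> q_tgt j = Suc l + i} = k"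
proof -
  have "j < J" if "j div k = i" for j
  proof -
    have "j < k * R" using that assms l_less_k by (auto simp: div_less_iff_less_mult mult.commute)
    then show ?thesis by (simp add: J_def)
  qed
  then have "{j. j < N \<and> q_tgt j = Suc l + i} = {j. j < R * k \<and> j div k = i}"
    using assms l_less_k
    by (auto simp: q_tgt_def N_def div_less_iff_less_mult intro: trans_less_add1)
  then show ?thesis using assms by (simp add: card_div_eq)
qed

lemma out_last: "{j. j < N \<and> q_src j = Suc l + R} = {}"
proof -
  have "q_src j < Suc l + R" if "j < N" for j
    using src_less_tgt[OF that] tgt_less[OF that] by (simp add: K_def)
  then show ?thesis by fastforce
qed

lemma in_last: "{j. j < N \<and> q_tgt j = Suc l + R} = {k * R..<N}"
proof -
  have "j div k = R \<longleftrightarrow> k * R \<le> j" if "j < J" for j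
    using that l_less_k div_le_R[OF that]
    by (auto simp: le_antisym less_eq_div_iff_mult_less_eq mult.commute)
  then show ?thesis using l_less_k by (auto simp: q_tgt_def J_def N_def)
qed

lemma node_cases:
  assumes "x < K"
  obtains "x \<le> l" | i where "i < R" "x = Suc l + i" | "x = Suc l + R"
proof -
  have "x \<le> l \<or> x - Suc l < R \<and> x = Suc l + (x - Suc l) \<or> x = Suc l + R"
    using assms unfolding K_def by linarith
  then show thesis using that by blast
qed

lemma regular_queue: "regular blowup (k + l)"
proof (rule regular_blowup)
  fix x assume "x < K"
  then show "card {j. j < N \<and> q_src j = x} + card {j. j < N \<and> q_tgt j = x} = k + l"
  proof (cases rule: node_cases)
    case 1
    then show ?thesis by (simp only: out_source in_source) simp
  next
    case 2
    then show ?thesis by (simp only: out_middle in_middle)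
  next
    case 3
    \<comment> \<open>The last node receives \<open>k - 1\<close> queue edges and
      \<open>l + 1\<close> direct edges.\<close>
    then show ?thesis using l_less_k by (simp only: out_last in_last) (simp add: J_def N_def)
  qed
qed

section \<open>The removal sequence with saves\<close>

definition saved :: "nat \<Rightarrow> nat option" where
  "saved u = (let x = u div N in if 1 \<le> x \<and> x \<le> l then Some (succ u (J + x)) else None)"

lemma q_J: "x \<le> l \<Longrightarrow> q_src (J + x) = x" "q_tgt (J + x) = Suc l + R"
    "x \<le> l \<Longrightarrow> J + x < N"
  using balance by (auto simp: q_src_def q_tgt_def J_def N_def)

text \<open>Sources \<open>1\<close> to \<open>l\<close> save along their direct edges. Source
  \<open>0\<close> does not: it must first lower the last vertices below the full value
  \<open>k\<close>, so that the later sources may save them.\<close>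

lemma weakly_degenerate_queue: "weakly_degenerate blowup k"
  unfolding blowup_def
proof (rule weakly_degenerate_natural_order[where sv = saved])
  show "u < v" if "adj u v" for u v using that by (rule adj_less)
  show "card {u. u < v \<and> adj u v \<and> saved u \<noteq> Some v} \<le> k" if "v < K * N" for v
  proof -
    have x: "v div N < K" using that by (rule less_mult_imp_div_less)
    define S where "S = {j. j < N \<and> q_tgt j = v div N \<and> j \<le> J}"
    have "{u. u < v \<and> adj u v \<and> saved u \<noteq> Some v} \<subseteq> pred v ` S"
    proof
      fix u assume u: "u \<in> {u. u < v \<and> adj u v \<and> saved u \<noteq> Some v}"
      then obtain j where j: "j < N" "q_tgt j = v div N" "u = pred v j"
        by (auto simp: adj_pred_iff)
      \<comment> \<open>An edge \<open>J + i\<close> with \<open>i \<ge> 1\<close> is a direct edge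
        whose earlier endpoint saves \<open>v\<close>.\<close>
      have "j \<le> J"
      proof (rule ccontr)
        assume "\<not> ?thesis"
        define i where "i = j - J"
        have i: "j = J + i" "1 \<le> i" "i \<le> l"
          using j(1) \<open>\<not> j \<le> J\<close> by (auto simp: i_def N_def)
        have "u div N = i" using j(1) q_J(1)[OF i(3)] by (simp add: j(3) i(1))
        then have "saved u = Some (succ u j)" using i by (simp add: saved_def)
        then show False using u succ_pred[of j v] j by simp
      qed
      then show "u \<in> pred v ` S" using j by (auto simp: S_def)
    qed
    then have "card {u. u < v \<and> adj u v \<and> saved u \<noteq> Some v} \<le> card S"
      by (rule surj_card_le[rotated]) (simp add: S_def)
    also have "card S \<le> k"
      using x
    proof (cases rule: node_cases)
      case 1
      then have "S = {}" unfolding S_def using in_source by blast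
      then show ?thesis by simp
    next
      case (2 i)
      have "card S \<le> card {j. j < N \<and> q_tgt j = v div N}"
        by (rule card_mono) (auto simp: S_def)
      then show ?thesis by (simp only: 2 in_middle)
    next
      case 3
      \<comment> \<open>The \<open>k - 1\<close> queue edges and the direct edge \<open>J\<close>
        from source \<open>0\<close> make exactly \<open>k\<close>.\<close>
      have "S \<subseteq> {k * R..J}" using in_last 3 unfolding S_def by fastforce
      then have "card S \<le> card {k * R..J}" by (intro card_mono) auto
      then show ?thesis using l_less_k by (simp add: J_def)
    qed
    finally show ?thesis .
  qed
  show "w < K * N \<and> adj u w \<and>
      card {x. x < u \<and> adj x u \<and> saved x \<noteq> Some u} <
      card {x. x < u \<and> adj x w \<and> saved x \<noteq> Some w}"
    if "u < K * N" "saved u = Some w" for u w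
  proof -
    define i where "i = u div N"
    have i: "1 \<le> i" "i \<le> l" and w: "w = succ u (J + i)"
      using that(2) by (auto simp: saved_def i_def Let_def split: if_splits)
    have wdiv: "w div N = Suc l + R" using i q_J by (simp add: w)
    then have "w < K * N" using less_iff_div by (simp add: K_def N_def)
    moreover have "adj u w"
      using i q_J by (auto simp: adj_succ_iff w i_def intro!: exI[of _ "J + i"])
    moreover have "{x. x < u \<and> adj x u \<and> saved x \<noteq> Some u} = {}"
      using in_source i by (auto simp: adj_pred_iff i_def)
    \<comment> \<open>The neighbour of \<open>w\<close> in source \<open>0\<close> precedes
      \<open>u\<close> and saves nothing, so \<open>w\<close> has already lost 1, while
      \<open>u\<close> has lost nothing.\<close>
    moreover have "pred w J \<in> {x. x < u \<and> adj x w \<and> saved x \<noteq> Some w}"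
    proof -
      have 0: "pred w J div N = 0" using q_J(1,3)[of 0] by simp
      then have "pred w J div N < u div N" using i(1) by (simp add: i_def)
      then have "pred w J < u" by (meson div_le_mono not_le)
      moreover have "adj (pred w J) w" using q_J(2,3)[of 0] wdiv by (auto simp: adj_pred_iff)
      moreover have "saved (pred w J) = None" using 0 by (simp add: saved_def)
      ultimately show ?thesis by simp
    qed
    then have "card {x. x < u \<and> adj x w \<and> saved x \<noteq> Some w} > 0"
      by (subst card_gt_0_iff) auto
    ultimately show ?thesis by (simp only: card.empty)
  qed
qed

lemma verts_blowup_nonempty: "verts blowup \<noteq> {}"
  unfolding blowup_def by (simp add: K_def N_def lessThan_empty_iff)

end

section \<open>Parameters for every degree\<close>

lemma ex_queue_multigraph:
  assumes "d \<ge> 1"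
  shows "\<exists>R. queue_multigraph (d div 2 + 1) (d - (d div 2 + 1)) R"
proof (cases "even d")
  case True
  then obtain m where "d = 2 * m" by blast
  then obtain a where "d = 2 * Suc a" using assms by (cases m) auto
  \<comment> \<open>\<open>R\<close> solves \<open>balance\<close>, that is
    \<open>R * (k - l) = Suc l * (k + l - 1) - (k - 1)\<close>. Here \<open>k - l = 2\<close> and
    the right side is \<open>2 * a * Suc a\<close>.\<close>
  then have "queue_multigraph (d div 2 + 1) (d - (d div 2 + 1)) (Suc a * a)"
    by unfold_locales (auto simp: algebra_simps)
  then show ?thesis ..
next
  case False
  then obtain m where "d = 2 * m + 1" by (rule oddE)
  \<comment> \<open>Now \<open>k = m + 1\<close> and \<open>l = m\<close>, so
    \<open>k - l = 1\<close> and \<open>R\<close> is the right side itself.\<close>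
  then have "queue_multigraph (d div 2 + 1) (d - (d div 2 + 1)) (m * (2 * m + 1))"
    by unfold_locales (auto simp: algebra_simps)
  then show ?thesis ..
qed

theorem theorem1:
  fixes d :: nat
  assumes "d \<ge> 1"
  shows "\<exists>G :: (nat, nat \<times> nat) pre_digraph.
    graph G \<and> verts G \<noteq> {} \<and> regular G d \<and> wd G = d div 2 + 1"
proof -
  let ?k = "d div 2 + 1"
  obtain R where "queue_multigraph ?k (d - ?k) R" using ex_queue_multigraph[OF assms] ..
  then interpret queue_multigraph ?k "d - ?k" R .
  have "?k + (d - ?k) = d" using assms by linarith
  then have reg: "regular blowup d" using regular_queue by metis
  have "wd blowup \<le> ?k"
    unfolding wd_def using weakly_degenerate_queue by (rule Least_le)
  moreover have "finite (verts blowup)" unfolding blowup_def by simp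
  then have "?k \<le> wd blowup"
    using weakly_degenerate_regular_ge[OF graph_blowup verts_blowup_nonempty reg assms]
      weakly_degenerate_wd by blast
  ultimately have "wd blowup = ?k" by (rule antisym)
  then show ?thesis using graph_blowup verts_blowup_nonempty reg by blast
qed

end
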